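(* For all $A,B,B',C\in\widehat{\mathbb F_q}$ and all $x,y,t\in\mathbb F_q$, $$\frac1{q-1}\sum_\theta\binom{B\theta}{\theta}\mathbb F_1(A;B\theta,B';C;x,y)\,\theta(t)=\varepsilon(t)\,\overline B(1-t)\;\mathbb F_1\left(A;B,B';C;\frac x{1-t},y\right)-\varepsilon(y)\,\overline B(-t)\,B'\overline C(x)\,\overline AC(1-x)\,\overline{B'}(x-y),$$ where $\theta$ ranges over all of $\widehat{\mathbb F_q}$.
   Context: Let $p$ be a prime, $r\ge1$ an integer, $q=p^r$, and $\mathbb F_q$ the finite field with $q$ elements. $\widehat{\mathbb F_q}$ denotes the group of (complex-valued) multiplicative characters of $\mathbb F_q^*$; every character $\chi$, including the trivial character $\varepsilon$, is extended to $\mathbb F_q$ by $\chi(0)=0$. $\overline\chi$ is the inverse of $\chi$. Juxtaposition of characters denotes their product, and e.g. $AC(-1)$ means $(AC)(-1)$, $\overline AC$ means the product of $\overline A$ and $C$, and $B'\overline C(x)$ is the value of the product character $B'\overline C$ at $x$. For $A,B\in\widehat{\mathbb F_q}$, the Jacobi sum is $J(A,B)=\sum_{u\in\mathbb F_q}A(u)B(1-u)$, and $$\binom AB=B(-1)J(A,\overline B).$$ For $A,B,B',C\in\widehat{\mathbb F_q}$ and $x,y\in\mathbb F_q$, $$\mathbb F_1(A;B,B';C;x,y)=\varepsilon(xy)\,AC(-1)\sum_{u\in\mathbb F_q}A(u)\,\overline AC(1-u)\,\overline B(1-ux)\,\overline{B'}(1-uy).$$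
   Formalization: The identity is stated for t ≠ 1 only: at t = 1 the argument x/(1−t) is undefined, and reading the first term on the right as 0 makes the identity false (q = 3, all characters trivial, x = y = t = 1: the left side is 1, the right side 0). *)

theory Defs
  imports Complex_Main "HOL-Library.Cardinality" "HOL-Library.FuncSet" "HOL-Computational_Algebra.Primes"
begin

text \<open>
  A finite field is a type of class \<open>{field, finite}\<close>. A multiplicative character is represented
  by its extension by zero to the whole field, so that distinct characters are distinct functions.
\<close>

definition mult_chars :: "('a::field \<Rightarrow> complex) set" where
  "mult_chars = {\<chi>. \<chi> 0 = 0 \<and> (\<forall>x. x \<noteq> 0 \<longrightarrow> \<chi> x \<noteq> 0) \<and>
                     (\<forall>x y. x \<noteq> 0 \<longrightarrow> y \<noteq> 0 \<longrightarrow> \<chi> (x * y) = \<chi> x * \<chi> y)}"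

definition triv_char :: "'a::field \<Rightarrow> complex" where
  "triv_char x = (if x = 0 then 0 else 1)"

definition char_mult :: "('a::field \<Rightarrow> complex) \<Rightarrow> ('a \<Rightarrow> complex) \<Rightarrow> 'a \<Rightarrow> complex"
    (infixl \<open>\<odot>\<close> 75) where
  "(\<chi> \<odot> \<psi>) x = \<chi> x * \<psi> x"

text \<open>Since \<open>inverse 0 = 0\<close>, this is again extended by zero.\<close>

definition char_inv :: "('a::field \<Rightarrow> complex) \<Rightarrow> 'a \<Rightarrow> complex" where
  "char_inv \<chi> x = inverse (\<chi> x)"

lemma triv_char_in_mult_chars: "triv_char \<in> mult_chars"
  by (simp add: mult_chars_def triv_char_def)

lemma char_mult_in_mult_chars: "\<chi> \<in> mult_chars \<Longrightarrow> \<psi> \<in> mult_chars \<Longrightarrow> \<chi> \<odot> \<psi> \<in> mult_chars"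
  by (simp add: mult_chars_def char_mult_def)

lemma char_inv_in_mult_chars: "\<chi> \<in> mult_chars \<Longrightarrow> char_inv \<chi> \<in> mult_chars"
  by (simp add: mult_chars_def char_inv_def)

lemma char_mult_char_inv: "\<chi> \<in> mult_chars \<Longrightarrow> \<chi> \<odot> char_inv \<chi> = triv_char"
  by (rule ext) (simp add: mult_chars_def char_mult_def char_inv_def triv_char_def)

text \<open>Sums over \<^const>\<open>mult_chars\<close> are genuine finite sums:\<close>

lemma finite_mult_chars: "finite (mult_chars :: ('a::{field,finite} \<Rightarrow> complex) set)"
proof -
  let ?N = "card (UNIV - {0::'a})"
  let ?S = "insert 0 {z::complex. z ^ ?N = 1}"
  have "(0::'a) \<noteq> 1" by simp
  hence N: "?N > 0" by (metis card_gt_0_iff finite DiffI UNIV_I empty_iff singletonD)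
  have root: "\<chi> x ^ ?N = 1" if c: "\<chi> \<in> mult_chars" and x: "x \<noteq> 0" for \<chi> and x :: 'a
  proof -
    have bij: "bij_betw (\<lambda>y. x * y) (UNIV - {0}) (UNIV - {0})"
      by (rule bij_betw_byWitness[where f' = "\<lambda>y. y / x"]) (use x in auto)
    have "(\<Prod>y\<in>UNIV - {0}. \<chi> y) = (\<Prod>y\<in>UNIV - {0}. \<chi> (x * y))"
      using prod.reindex_bij_betw[OF bij, of \<chi>] by simp
    also have "\<dots> = (\<Prod>y\<in>UNIV - {0}. \<chi> x * \<chi> y)"
      by (rule prod.cong) (use c x in \<open>auto simp: mult_chars_def\<close>)
    also have "\<dots> = \<chi> x ^ ?N * (\<Prod>y\<in>UNIV - {0}. \<chi> y)"
      by (simp add: prod.distrib)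
    finally show ?thesis using c by (auto simp: mult_chars_def)
  qed
  have "(mult_chars :: ('a \<Rightarrow> complex) set) \<subseteq> PiE UNIV (\<lambda>_. ?S)"
  proof
    fix \<chi> :: "'a \<Rightarrow> complex" assume c: "\<chi> \<in> mult_chars"
    have "\<chi> x \<in> ?S" for x
      using root[OF c, of x] c by (cases "x = 0") (auto simp: mult_chars_def)
    thus "\<chi> \<in> PiE UNIV (\<lambda>_. ?S)" by (simp add: PiE_def Pi_def)
  qed
  moreover have "finite ?S"
    using finite_roots_unity[of ?N, where 'a = complex] N by auto
  hence "finite (PiE (UNIV :: 'a set) (\<lambda>_. ?S))"
    by (intro finite_PiE) auto
  ultimately show ?thesis by (rule finite_subset)
qed

definition jacobi_sum :: "('a::{field,finite} \<Rightarrow> complex) \<Rightarrow> ('a \<Rightarrow> complex) \<Rightarrow> complex" where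
  "jacobi_sum A B = (\<Sum>u\<in>UNIV. A u * B (1 - u))"

text \<open>Normalized without the factor \<open>1 / q\<close> used by Greene.\<close>

definition char_binom :: "('a::{field,finite} \<Rightarrow> complex) \<Rightarrow> ('a \<Rightarrow> complex) \<Rightarrow> complex" where
  "char_binom A B = B (- 1) * jacobi_sum A (char_inv B)"

definition appell_F1 ::
  "('a::{field,finite} \<Rightarrow> complex) \<Rightarrow> ('a \<Rightarrow> complex) \<Rightarrow> ('a \<Rightarrow> complex) \<Rightarrow> ('a \<Rightarrow> complex)
     \<Rightarrow> 'a \<Rightarrow> 'a \<Rightarrow> complex" where
  "appell_F1 A B B' C x y =
     triv_char (x * y) * (A \<odot> C) (- 1) *
     (\<Sum>u\<in>UNIV. A u * (char_inv A \<odot> C) (1 - u) * char_inv B (1 - u * x) * char_inv B' (1 - u * y))"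

end

theory Submission
  imports Defs "HOL-Algebra.Multiplicative_Group"
begin

text \<open>
  Both sides vanish if one of \<open>x\<close>, \<open>y\<close>, \<open>t\<close> is \<open>0\<close>. Otherwise, the idea is to pull the sum over \<open>\<theta>\<close> inside the sum over \<open>u\<close> that defines \<^const>\<open>appell_F1\<close>. The
  only factors that depend on \<open>\<theta>\<close> are then the binomial coefficient of \<open>B \<odot> \<theta>\<close> over \<open>\<theta>\<close>, the inverse
  of \<open>B \<odot> \<theta>\<close> at \<open>w = 1 - u * x\<close>, and \<open>\<theta> t\<close>. For \<open>w \<noteq> 0\<close> their sum is evaluated by the finite field
  analogue of the binomial series \<open>(1 - s) powr (- b)\<close>, taken at \<open>s = t / w\<close>
  (\<open>char_binomial_theorem\<close>), and the result is \<open>(q - 1) * char_inv B (w - t)\<close>.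

  For \<open>t \<noteq> 1\<close>, \<open>w - t = (1 - t) * (1 - u * (x / (1 - t)))\<close>, so summing \<open>char_inv B (w - t)\<close> against
  the rest of the summand over \<^emph>\<open>all\<close> \<open>u\<close> gives \<open>char_inv B (1 - t)\<close> times the series \<open>F1\<close> at
  \<open>x / (1 - t)\<close>. But for \<open>w = 0\<close>, that is \<open>u = 1 / x\<close>, every term on the left vanishes, since a character
  is \<open>0\<close> at \<open>0\<close>, whereas \<open>char_inv B (0 - t)\<close> does not. The second term on the right removes this
  single summand.

  The binomial theorem itself is orthogonality: expanding the Jacobi sum over \<open>v\<close>, the sum over \<open>\<theta>\<close>
  selects the \<open>v\<close> with \<open>- s * v / (1 - v) = 1\<close>, which is \<open>1 / (1 - s)\<close> for \<open>s \<noteq> 1\<close>. Orthogonality in turn needs that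
  characters separate the points of the multiplicative group, which follows from its cyclicity, and
  that there are \<open>q - 1\<close> characters (\<open>card_mult_chars\<close>).
\<close>

section \<open>Multiplicative characters of a finite field\<close>

(* The scalar multiplication of modules uses the same symbol as the product of characters. *)
no_notation Module.smult (infixl \<open>\<odot>\<index>\<close> 70)

text \<open>
  The cyclicity theorem for explicit field structures is transferred to the type class by viewing
  the whole type as the carrier of such a structure.
\<close>

lemma finite_field_generator:
  obtains g :: "'a::{field,finite}" where "g \<noteq> 0" "\<And>x. x \<noteq> 0 \<Longrightarrow> \<exists>i::nat. x = g ^ i"
proof -
  define R :: "'a ring" where
    "R = \<lparr>carrier = UNIV, mult = (*), one = 1, zero = 0, add = (+)\<rparr>"
  have R_simps: "carrier R = UNIV" "mult R = (*)" "one R = 1" "zero R = 0" "add R = (+)"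
    by (simp_all add: R_def)
  have "abelian_group R"
  proof (rule abelian_groupI)
    show "\<exists>y\<in>carrier R. y \<oplus>\<^bsub>R\<^esub> x = \<zero>\<^bsub>R\<^esub>" for x
      by (rule bexI[of _ "- x"]) (simp_all add: R_simps)
  qed (simp_all add: R_simps algebra_simps)
  moreover have "comm_monoid R"
    by (rule comm_monoidI) (simp_all add: R_simps algebra_simps)
  ultimately have "cring R"
    by (rule cringI) (simp add: R_simps algebra_simps)
  hence "Ring.field R"
  proof (rule cring.cring_fieldI2)
    show "\<exists>b\<in>carrier R. a \<otimes>\<^bsub>R\<^esub> b = \<one>\<^bsub>R\<^esub>" if "a \<noteq> \<zero>\<^bsub>R\<^esub>" for a
      using that by (intro bexI[of _ "inverse a"]) (simp_all add: R_simps)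
  qed (simp add: R_simps)
  moreover have "finite (carrier R)"
    by (simp add: R_simps)
  ultimately obtain g where g: "g \<in> carrier (mult_of R)"
    "carrier (mult_of R) = {g [^]\<^bsub>R\<^esub> i | i::nat. i \<in> UNIV}"
    using field.finite_field_mult_group_has_gen by blast
  have pow: "g [^]\<^bsub>R\<^esub> (i::nat) = g ^ i" for i
    by (induction i) (simp_all add: R_simps nat_pow_def mult.commute)
  show thesis
  proof (rule that)
    show "g \<noteq> 0" using g(1) by (simp add: R_simps)
    show "\<exists>i::nat. x = g ^ i" if "x \<noteq> 0" for x
      using that g(2) unfolding pow by (auto simp: R_simps)
  qed
qed

lemma finite_field_power_card_minus_1:
  fixes x :: "'a::{field,finite}"
  assumes "x \<noteq> 0"
  shows "x ^ (CARD('a) - 1) = 1"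
proof -
  have bij: "bij_betw (\<lambda>y. x * y) (UNIV - {0}) (UNIV - {0})"
    by (rule bij_betw_byWitness[where f' = "\<lambda>y. y / x"]) (use assms in auto)
  have "(\<Prod>y\<in>UNIV - {0}. y) = (\<Prod>y\<in>UNIV - {0}. x * y)"
    using prod.reindex_bij_betw[OF bij, of "\<lambda>y. y"] by simp
  also have "\<dots> = x ^ (CARD('a) - 1) * (\<Prod>y\<in>UNIV - {0}. y)"
    by (simp add: prod.distrib card_Diff_subset)
  finally show ?thesis by auto
qed

lemma mult_char_0: "\<chi> \<in> mult_chars \<Longrightarrow> \<chi> 0 = 0"
  by (simp add: mult_chars_def)

lemma mult_char_nonzero: "\<chi> \<in> mult_chars \<Longrightarrow> x \<noteq> 0 \<Longrightarrow> \<chi> x \<noteq> 0"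
  by (simp add: mult_chars_def)

lemma mult_char_mult: "\<chi> \<in> mult_chars \<Longrightarrow> \<chi> (x * y) = \<chi> x * \<chi> y"
  by (cases "x = 0"; cases "y = 0") (simp_all add: mult_chars_def)

lemma mult_char_1: "\<chi> \<in> mult_chars \<Longrightarrow> \<chi> 1 = 1"
  using mult_char_mult[of \<chi> 1 1] mult_char_nonzero[of \<chi> 1] by simp

lemma mult_char_inverse:
  assumes "\<chi> \<in> mult_chars"
  shows "\<chi> (inverse x) = inverse (\<chi> x)"
proof (cases "x = 0")
  case False
  hence "\<chi> x * \<chi> (inverse x) = 1"
    using mult_char_mult[OF assms, of x "inverse x"] mult_char_1[OF assms] by simp
  thus ?thesis by (metis inverse_unique)
qed (simp add: mult_char_0[OF assms])

lemma mult_char_divide: "\<chi> \<in> mult_chars \<Longrightarrow> \<chi> (x / y) = \<chi> x / \<chi> y"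
  by (simp add: divide_inverse mult_char_mult mult_char_inverse)

lemma mult_char_minus_1_square: "\<chi> \<in> mult_chars \<Longrightarrow> \<chi> (- 1) * \<chi> (- 1) = 1"
  using mult_char_mult[of \<chi> "- 1" "- 1"] mult_char_1[of \<chi>] by simp

text \<open>
  Once the nonzero elements are written as powers of a generator \<open>g\<close>, sending \<open>g\<close> to a primitive root
  of unity of order \<open>q - 1\<close> defines an injective character, so a single \<open>\<psi>\<close> separates every \<open>a\<close> from \<open>1\<close>.
\<close>

lemma mult_chars_separate:
  fixes a :: "'a::{field,finite}"
  assumes "a \<noteq> 0" and "a \<noteq> 1"
  obtains \<psi> where "\<psi> \<in> mult_chars" "\<psi> a \<noteq> 1"
proof -
  define N where "N = CARD('a) - 1"
  have cardN: "card (UNIV - {0::'a}) = N"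
    by (simp add: N_def card_Diff_subset)
  have N: "N > 0"
    unfolding cardN[symmetric] using assms(1) by (intro card_gt_0_iff[THEN iffD2]) auto
  obtain g :: 'a where g: "g \<noteq> 0" "\<And>x. x \<noteq> 0 \<Longrightarrow> \<exists>i::nat. x = g ^ i"
    by (rule finite_field_generator) blast
  have mod_N: "g ^ i = g ^ (i mod N)" for i
  proof -
    have "g ^ i = g ^ (N * (i div N) + i mod N)" by simp
    also have "\<dots> = g ^ (i mod N)"
      using finite_field_power_card_minus_1[OF g(1)]
      by (simp only: power_add power_mult N_def[symmetric]) simp
    finally show ?thesis .
  qed
  have img: "(\<lambda>i. g ^ i) ` {..<N} = UNIV - {0}"
  proof
    show "UNIV - {0} \<subseteq> (\<lambda>i. g ^ i) ` {..<N}"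
    proof
      fix x :: 'a assume "x \<in> UNIV - {0}"
      then obtain i where "x = g ^ i" using g(2) by blast
      hence "x = g ^ (i mod N)" using mod_N[of i] by simp
      thus "x \<in> (\<lambda>i. g ^ i) ` {..<N}" using N by (intro image_eqI[of _ _ "i mod N"]) simp_all
    qed
  qed (use g(1) in auto)
  have inj: "inj_on (\<lambda>i. g ^ i) {..<N}"
    by (rule eq_card_imp_inj_on) (simp_all add: img cardN)
  have cong: "i mod N = j mod N" if "g ^ i = g ^ j" for i j
    using inj_onD[OF inj, of "i mod N" "j mod N"] that mod_N[of i] mod_N[of j] N by simp
  define \<zeta> where "\<zeta> k = cis (2 * pi * real k / real N)" for k :: nat
  have zeta_bij: "bij_betw \<zeta> {..<N} {z. z ^ N = 1}"
    using bij_betw_roots_unity[OF N] unfolding \<zeta>_def .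
  have zeta_add: "\<zeta> (i + j) = \<zeta> i * \<zeta> j" for i j
    by (simp add: \<zeta>_def cis_mult add_divide_distrib algebra_simps)
  have zeta_mod: "\<zeta> i = \<zeta> (i mod N)" for i
  proof -
    have "\<zeta> (N * k) = 1" for k
      using N cis_multiple_2pi[of "real k"] by (simp add: \<zeta>_def mult.assoc)
    hence "\<zeta> (N * (i div N) + i mod N) = \<zeta> (i mod N)"
      by (simp only: zeta_add) simp
    thus ?thesis by simp
  qed
  define lg where "lg x = (SOME i::nat. x = g ^ i)" for x
  have lg: "g ^ lg x = x" if "x \<noteq> 0" for x
    using someI_ex[OF g(2)[OF that]] unfolding lg_def by simp
  define \<psi> where "\<psi> x = (if x = 0 then 0 else \<zeta> (lg x))" for x
  show thesis
  proof (rule that)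
    have "\<zeta> (lg (x * y)) = \<zeta> (lg x) * \<zeta> (lg y)" if "x \<noteq> 0" "y \<noteq> 0" for x y
    proof -
      have "g ^ lg (x * y) = g ^ (lg x + lg y)"
        using that by (simp add: lg power_add)
      hence "lg (x * y) mod N = (lg x + lg y) mod N" by (rule cong)
      hence "\<zeta> (lg (x * y)) = \<zeta> (lg x + lg y)" using zeta_mod by metis
      thus ?thesis by (simp add: zeta_add)
    qed
    thus "\<psi> \<in> mult_chars"
      by (auto simp: mult_chars_def \<psi>_def \<zeta>_def)
    have "lg a mod N \<noteq> 0"
    proof
      assume "lg a mod N = 0"
      with mod_N[of "lg a"] lg[OF assms(1)] assms(2) show False by simp
    qed
    hence "\<zeta> (lg a mod N) \<noteq> \<zeta> 0"
      using inj_onD[OF bij_betw_imp_inj_on[OF zeta_bij], of "lg a mod N" 0] N by auto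
    thus "\<psi> a \<noteq> 1"
      using assms(1) zeta_mod[of "lg a"] by (simp add: \<psi>_def) (simp add: \<zeta>_def)
  qed
qed

section \<open>Orthogonality\<close>

text \<open>
  Multiplication by a character \<open>\<psi>\<close> permutes the characters, so the sum equals \<open>\<psi> a\<close> times itself;
  choose \<open>\<psi>\<close> with \<open>\<psi> a \<noteq> 1\<close>.
\<close>

lemma sum_mult_chars_eq_0:
  fixes a :: "'a::{field,finite}"
  assumes "a \<noteq> 1"
  shows "(\<Sum>\<theta>\<in>mult_chars. \<theta> a) = 0"
proof (cases "a = 0")
  case True
  thus ?thesis by (simp add: mult_char_0)
next
  case False
  then obtain \<psi> where \<psi>: "\<psi> \<in> mult_chars" "\<psi> a \<noteq> 1"
    using assms mult_chars_separate by blast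
  have cancel: "\<psi> \<odot> (char_inv \<psi> \<odot> \<theta>) = \<theta>" "char_inv \<psi> \<odot> (\<psi> \<odot> \<theta>) = \<theta>"
    if "\<theta> \<in> mult_chars" for \<theta>
  proof -
    have "\<psi> x * (inverse (\<psi> x) * \<theta> x) = \<theta> x" "inverse (\<psi> x) * (\<psi> x * \<theta> x) = \<theta> x" for x
      using mult_char_nonzero[OF \<psi>(1), of x] mult_char_0[OF that]
      by (cases "x = 0"; simp)+
    thus "\<psi> \<odot> (char_inv \<psi> \<odot> \<theta>) = \<theta>" "char_inv \<psi> \<odot> (\<psi> \<odot> \<theta>) = \<theta>"
      by (simp_all add: fun_eq_iff char_mult_def char_inv_def)
  qed
  have bij: "bij_betw (\<lambda>\<theta>. \<psi> \<odot> \<theta>) mult_chars mult_chars"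
    by (rule bij_betw_byWitness[where f' = "\<lambda>\<theta>. char_inv \<psi> \<odot> \<theta>"])
       (use cancel \<psi>(1) in \<open>auto intro: char_mult_in_mult_chars char_inv_in_mult_chars\<close>)
  have "(\<Sum>\<theta>\<in>mult_chars. \<theta> a) = (\<Sum>\<theta>\<in>mult_chars. (\<psi> \<odot> \<theta>) a)"
    by (rule sum.reindex_bij_betw[OF bij, symmetric])
  also have "\<dots> = \<psi> a * (\<Sum>\<theta>\<in>mult_chars. \<theta> a)"
    by (simp add: char_mult_def sum_distrib_left)
  finally show ?thesis using \<psi>(2) by (metis mult_cancel_right1)
qed

text \<open>
  The dual argument: multiplication by some \<open>b\<close> with \<open>\<theta> b \<noteq> 1\<close> permutes the field.
\<close>

lemma sum_mult_char_eq_0: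
  fixes \<theta> :: "'a::{field,finite} \<Rightarrow> complex"
  assumes \<theta>: "\<theta> \<in> mult_chars" and "\<theta> \<noteq> triv_char"
  shows "(\<Sum>x\<in>UNIV. \<theta> x) = 0"
proof -
  obtain b where "\<theta> b \<noteq> triv_char b"
    using assms(2) by (meson ext)
  hence b: "b \<noteq> 0" "\<theta> b \<noteq> 1"
    using mult_char_0[OF \<theta>] by (auto simp: triv_char_def split: if_splits)
  have bij: "bij_betw (\<lambda>x. b * x) UNIV UNIV"
    by (rule bij_betw_byWitness[where f' = "\<lambda>x. x / b"]) (use b in auto)
  have "(\<Sum>x\<in>UNIV. \<theta> x) = (\<Sum>x\<in>UNIV. \<theta> (b * x))"
    by (rule sum.reindex_bij_betw[OF bij, symmetric])
  also have "\<dots> = \<theta> b * (\<Sum>x\<in>UNIV. \<theta> x)"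
    by (simp add: mult_char_mult[OF \<theta>] sum_distrib_left)
  finally show ?thesis using b(2) by (metis mult_cancel_right1)
qed

text \<open>
  Sum \<open>\<theta> x\<close> over all pairs \<open>(\<theta>, x)\<close> in both orders. By the two vanishing lemmas only \<open>x = 1\<close>
  contributes when \<open>\<theta>\<close> is summed first, giving the number of characters, and only the trivial
  character when \<open>x\<close> is summed first, giving the number of nonzero elements.
\<close>

lemma card_mult_chars:
  "of_nat (card (mult_chars :: ('a::{field,finite} \<Rightarrow> complex) set)) = (of_nat CARD('a) - 1 :: complex)"
proof -
  let ?X = "mult_chars :: ('a \<Rightarrow> complex) set"
  have "(\<Sum>x\<in>UNIV. \<Sum>\<theta>\<in>?X. \<theta> x) = (\<Sum>x\<in>UNIV. if x = (1::'a) then (\<Sum>\<theta>\<in>?X. \<theta> 1) else 0)"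
    by (rule sum.cong) (simp_all add: sum_mult_chars_eq_0)
  also have "\<dots> = of_nat (card ?X)"
    by (simp add: mult_char_1)
  finally have 1: "(\<Sum>x\<in>UNIV. \<Sum>\<theta>\<in>?X. \<theta> x) = of_nat (card ?X)" .
  have "(\<Sum>\<theta>\<in>?X. \<Sum>x\<in>UNIV. \<theta> x)
      = (\<Sum>\<theta>\<in>?X. if \<theta> = triv_char then (\<Sum>x\<in>UNIV. triv_char (x::'a)) else 0)"
    by (rule sum.cong) (simp_all add: sum_mult_char_eq_0)
  also have "\<dots> = (\<Sum>x\<in>UNIV. triv_char (x::'a))"
    by (simp add: finite_mult_chars triv_char_in_mult_chars)
  also have "\<dots> = (\<Sum>x\<in>UNIV - {0::'a}. 1)"
    by (rule sum.mono_neutral_cong_right) (auto simp: triv_char_def)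
  also have "\<dots> = of_nat CARD('a) - 1"
    by (simp add: card_Diff_subset)
  finally have 2: "(\<Sum>\<theta>\<in>?X. \<Sum>x\<in>UNIV. \<theta> x) = of_nat CARD('a) - 1" .
  show ?thesis
    unfolding 1[symmetric] 2[symmetric] by (rule sum.swap)
qed

lemma sum_mult_chars:
  fixes a :: "'a::{field,finite}"
  shows "(\<Sum>\<theta>\<in>mult_chars. \<theta> a) = (if a = 1 then of_nat CARD('a) - 1 else 0)"
  by (simp add: sum_mult_chars_eq_0 mult_char_1 card_mult_chars)

lemma card_minus_1_nonzero: "(of_nat CARD('a::{field,finite}) - 1 :: complex) \<noteq> 0"
proof -
  have "card {0, 1 :: 'a} \<le> CARD('a)" by (rule card_mono) auto
  thus ?thesis by auto
qed

section \<open>The finite field binomial theorem\<close>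

text \<open>
  This is the analogue of the expansion of \<open>(1 - s) powr (- b)\<close> into powers of \<open>s\<close>: the characters
  \<open>\<theta>\<close> take the place of the exponents, and the sum over \<open>\<theta>\<close> is evaluated by orthogonality inside the
  Jacobi sum.
\<close>

lemma char_binomial_theorem:
  fixes B :: "'a::{field,finite} \<Rightarrow> complex"
  assumes B: "B \<in> mult_chars" and "s \<noteq> 0"
  shows "(\<Sum>\<theta>\<in>mult_chars. char_binom (B \<odot> \<theta>) \<theta> * \<theta> s)
       = (of_nat CARD('a) - 1) * char_inv B (1 - s)"
proof -
  have "(\<Sum>\<theta>\<in>mult_chars. char_binom (B \<odot> \<theta>) \<theta> * \<theta> s)
      = (\<Sum>\<theta>\<in>mult_chars. \<Sum>v\<in>UNIV. B v * \<theta> (- s * v / (1 - v)))"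
  proof (rule sum.cong)
    fix \<theta> :: "'a \<Rightarrow> complex" assume \<theta>: "\<theta> \<in> mult_chars"
    have "\<theta> (- s * v / (1 - v)) = \<theta> (- 1) * \<theta> s * \<theta> v * inverse (\<theta> (1 - v))" for v
    proof -
      have "- s * v / (1 - v) = - 1 * s * v / (1 - v)" by simp
      thus ?thesis
        by (simp only: mult_char_divide[OF \<theta>] mult_char_mult[OF \<theta>]) (simp add: divide_inverse)
    qed
    thus "char_binom (B \<odot> \<theta>) \<theta> * \<theta> s = (\<Sum>v\<in>UNIV. B v * \<theta> (- s * v / (1 - v)))"
      by (simp add: char_binom_def jacobi_sum_def char_mult_def char_inv_def
          sum_distrib_left sum_distrib_right mult_ac)
  qed simp
  also have "\<dots> = (\<Sum>v\<in>UNIV. B v * (\<Sum>\<theta>\<in>mult_chars. \<theta> (- s * v / (1 - v))))"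
    by (subst sum.swap) (simp add: sum_distrib_left)
  also have "\<dots> = (\<Sum>v\<in>UNIV. if v = inverse (1 - s) then (of_nat CARD('a) - 1) * B v else 0)"
  proof (rule sum.cong)
    fix v :: 'a
    \<comment> \<open>For \<open>s = 1\<close> no \<open>v\<close> solves the equation; \<open>inverse (1 - s) = 0\<close> then stands for the
      harmless \<open>v = 0\<close>, where \<open>B\<close> vanishes.\<close>
    have "- s * v / (1 - v) = 1 \<longleftrightarrow> v * (1 - s) = 1"
    proof (cases "v = 1")
      case True
      thus ?thesis using \<open>s \<noteq> 0\<close> by simp
    next
      case False
      hence "- s * v / (1 - v) = 1 \<longleftrightarrow> - s * v = 1 - v"
        by (simp only: divide_eq_eq) simp
      also have "\<dots> \<longleftrightarrow> v * (1 - s) = 1"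
        by (auto simp: algebra_simps)
      finally show ?thesis .
    qed
    also have "\<dots> \<longleftrightarrow> s \<noteq> 1 \<and> v = inverse (1 - s)"
      by (auto simp: inverse_eq_divide eq_divide_eq)
    finally have "(- s * v / (1 - v) = 1) = (s \<noteq> 1 \<and> v = inverse (1 - s))" .
    thus "B v * (\<Sum>\<theta>\<in>mult_chars. \<theta> (- s * v / (1 - v)))
        = (if v = inverse (1 - s) then (of_nat CARD('a) - 1) * B v else 0)"
      by (simp only: sum_mult_chars) (auto simp: mult_char_0[OF B])
  qed simp
  also have "\<dots> = (of_nat CARD('a) - 1) * char_inv B (1 - s)"
    by (simp add: mult_char_inverse[OF B] char_inv_def)
  finally show ?thesis .
qed

text \<open>
  The form in which the theorem enters a series: the analogue of expanding \<open>(w - t) powr (- b)\<close>, obtained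
  by multiplying the theorem at \<open>t / w\<close> by \<open>char_inv B w\<close>. The case \<open>w = 0\<close>, where the left side is \<open>0\<close>
  but \<open>char_inv B (w - t)\<close> is not, is the source of the correction term in the final formula.
\<close>

lemma char_binomial_theorem_homogeneous:
  fixes B :: "'a::{field,finite} \<Rightarrow> complex"
  assumes B: "B \<in> mult_chars" and "t \<noteq> 0"
  shows "(\<Sum>\<theta>\<in>mult_chars. char_binom (B \<odot> \<theta>) \<theta> * char_inv (B \<odot> \<theta>) w * \<theta> t)
       = (if w = 0 then 0 else (of_nat CARD('a) - 1) * char_inv B (w - t))"
proof (cases "w = 0")
  case True
  thus ?thesis by (simp add: char_inv_def char_mult_def mult_char_0[OF B])
next
  case False
  have "(\<Sum>\<theta>\<in>mult_chars. char_binom (B \<odot> \<theta>) \<theta> * char_inv (B \<odot> \<theta>) w * \<theta> t)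
      = (\<Sum>\<theta>\<in>mult_chars. char_inv B w * (char_binom (B \<odot> \<theta>) \<theta> * \<theta> (t / w)))"
    by (rule sum.cong)
       (simp_all add: char_inv_def char_mult_def mult_char_mult mult_char_inverse
          divide_inverse mult_ac)
  also have "\<dots> = char_inv B w * ((of_nat CARD('a) - 1) * char_inv B (1 - t / w))"
    using False \<open>t \<noteq> 0\<close> by (simp add: sum_distrib_left[symmetric] char_binomial_theorem[OF B])
  also have "\<dots> = (of_nat CARD('a) - 1) * char_inv B (w * (1 - t / w))"
    by (simp add: mult_char_mult[OF char_inv_in_mult_chars[OF B]])
  also have "w * (1 - t / w) = w - t"
    using False by (simp add: field_simps)
  finally show ?thesis using False by simp
qed

section \<open>The generating function\<close>

theorem theorem4p2:
  fixes p r q :: nat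
    and A B B' C :: "'a::{field,finite} \<Rightarrow> complex"
    and x y t :: 'a
  assumes "prime p" and "r \<ge> 1" and "q = p ^ r" and "CARD('a) = q"
    and "A \<in> mult_chars" and "B \<in> mult_chars" and "B' \<in> mult_chars" and "C \<in> mult_chars"
    and "t \<noteq> 1"
  shows "1 / (of_nat q - 1) *
      (\<Sum>\<theta>\<in>mult_chars. char_binom (B \<odot> \<theta>) \<theta> * appell_F1 A (B \<odot> \<theta>) B' C x y * \<theta> t)
    = triv_char t * char_inv B (1 - t) * appell_F1 A B B' C (x / (1 - t)) y
      - triv_char y * char_inv B (- t) * (B' \<odot> char_inv C) x * (char_inv A \<odot> C) (1 - x)
        * char_inv B' (x - y)"
proof (cases "x = 0 \<or> y = 0 \<or> t = 0")
  case True
  \<comment> \<open>Every term carries a factor that vanishes at \<open>0\<close>.\<close>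
  thus ?thesis
    by (auto simp: appell_F1_def triv_char_def char_mult_def char_inv_def
        mult_char_0 assms(6) mult_char_0[OF assms(7)] sum.neutral)
next
  case False
  hence x: "x \<noteq> 0" and y: "y \<noteq> 0" and t: "t \<noteq> 0" by auto
  note A = assms(5) and B = assms(6) and B' = assms(7) and C = assms(8)
  note iB = char_inv_in_mult_chars[OF B] and iB' = char_inv_in_mult_chars[OF B']
    and iAC = char_mult_in_mult_chars[OF char_inv_in_mult_chars[OF A] C]
  let ?N = "of_nat CARD('a) - 1 :: complex"
  define K where "K u = A u * (char_inv A \<odot> C) (1 - u) * char_inv B' (1 - u * y)" for u
  (* H is the summand at u after the sum over \<theta>, up to the factor ?N, as if w = 1 - u * x were never 0. *)
  define H where "H u = K u * char_inv B (1 - u * x - t)" for u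
  have F1: "appell_F1 A D B' C z y
      = (A \<odot> C) (- 1) * (\<Sum>u\<in>UNIV. K u * char_inv D (1 - u * z))" if "z \<noteq> 0" for D z
    using that y by (simp add: appell_F1_def triv_char_def K_def mult_ac)
  have "(\<Sum>\<theta>\<in>mult_chars. char_binom (B \<odot> \<theta>) \<theta> * appell_F1 A (B \<odot> \<theta>) B' C x y * \<theta> t)
      = (A \<odot> C) (- 1) * (\<Sum>\<theta>\<in>mult_chars. \<Sum>u\<in>UNIV.
          K u * (char_binom (B \<odot> \<theta>) \<theta> * char_inv (B \<odot> \<theta>) (1 - u * x) * \<theta> t))"
    by (simp add: F1[OF x] sum_distrib_left sum_distrib_right mult_ac)
  also have "\<dots> = (A \<odot> C) (- 1) * (\<Sum>u\<in>UNIV. K u *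
      (\<Sum>\<theta>\<in>mult_chars. char_binom (B \<odot> \<theta>) \<theta> * char_inv (B \<odot> \<theta>) (1 - u * x) * \<theta> t))"
    by (subst sum.swap) (simp add: sum_distrib_left)
  also have "\<dots> = (A \<odot> C) (- 1) * (\<Sum>u\<in>UNIV. if 1 - u * x = 0 then 0 else ?N * H u)"
    unfolding char_binomial_theorem_homogeneous[OF B t] H_def
    by (intro arg_cong2[of _ _ _ _ "(*)"] sum.cong) auto
  also have "(\<Sum>u\<in>UNIV. if 1 - u * x = 0 then 0 else ?N * H u)
      = (\<Sum>u\<in>UNIV. ?N * H u - (if u = 1 / x then ?N * H u else 0))"
    by (rule sum.cong) (use x in \<open>auto simp: field_simps\<close>)
  also have "\<dots> = ?N * ((\<Sum>u\<in>UNIV. H u) - H (1 / x))"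
    by (simp add: sum_subtractf sum_distrib_left[symmetric] right_diff_distrib)
  finally have lhs: "1 / ?N *
      (\<Sum>\<theta>\<in>mult_chars. char_binom (B \<odot> \<theta>) \<theta> * appell_F1 A (B \<odot> \<theta>) B' C x y * \<theta> t)
      = (A \<odot> C) (- 1) * (\<Sum>u\<in>UNIV. H u) - (A \<odot> C) (- 1) * H (1 / x)"
    using card_minus_1_nonzero[where 'a = 'a] by (simp add: right_diff_distrib)

  have "H u = char_inv B (1 - t) * (K u * char_inv B (1 - u * (x / (1 - t))))" for u
  proof -
    have "1 - u * x - t = (1 - t) * (1 - u * (x / (1 - t)))"
      using \<open>t \<noteq> 1\<close> by (simp add: field_simps)
    thus ?thesis by (simp add: H_def mult_char_mult[OF iB])
  qed
  hence full: "(A \<odot> C) (- 1) * (\<Sum>u\<in>UNIV. H u)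
      = char_inv B (1 - t) * appell_F1 A B B' C (x / (1 - t)) y"
    using x \<open>t \<noteq> 1\<close> by (subst F1) (simp_all add: sum_distrib_left mult_ac)

  (* It remains to evaluate the excess summand at u = 1 / x. *)
  have "(char_inv A \<odot> C) (1 - 1 / x) = (char_inv A \<odot> C) (- 1 * (1 - x) / x)"
    using x by (simp add: field_simps)
  hence e1: "(char_inv A \<odot> C) (1 - 1 / x)
      = (char_inv A \<odot> C) (- 1) * (char_inv A \<odot> C) (1 - x) / (char_inv A \<odot> C) x"
    by (simp only: mult_char_mult[OF iAC] mult_char_divide[OF iAC])
  have "char_inv B' (1 - 1 / x * y) = char_inv B' ((x - y) / x)"
    using x by (simp add: field_simps)
  hence e2: "char_inv B' (1 - 1 / x * y) = char_inv B' (x - y) / char_inv B' x"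
    by (simp only: mult_char_divide[OF iB'])
  have e3: "char_inv B (1 - 1 / x * x - t) = char_inv B (- t)"
    using x by simp
  have e4: "(A \<odot> C) (- 1) * (char_inv A \<odot> C) (- 1) = 1"
    using mult_char_minus_1_square[OF C] mult_char_nonzero[OF A, of "- 1"]
    by (simp add: char_mult_def char_inv_def field_simps)
  have e5: "A (1 / x) / (char_inv A \<odot> C) x / char_inv B' x = (B' \<odot> char_inv C) x"
    using mult_char_nonzero[OF A x] mult_char_nonzero[OF B' x] mult_char_nonzero[OF C x]
    by (simp add: char_mult_def char_inv_def mult_char_divide[OF A] mult_char_1[OF A] field_simps)
  have "(A \<odot> C) (- 1) * H (1 / x)
      = ((A \<odot> C) (- 1) * (char_inv A \<odot> C) (- 1)) * char_inv B (- t)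
        * (A (1 / x) / (char_inv A \<odot> C) x / char_inv B' x)
        * (char_inv A \<odot> C) (1 - x) * char_inv B' (x - y)"
    unfolding H_def K_def e1 e2 e3 by (simp add: divide_inverse mult_ac)
  also have "\<dots> = char_inv B (- t) * (B' \<odot> char_inv C) x * (char_inv A \<odot> C) (1 - x)
        * char_inv B' (x - y)"
    unfolding e4 e5 by simp
  finally show ?thesis
    using lhs full y t \<open>CARD('a) = q\<close> by (simp add: triv_char_def)
qed

end
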